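(* Let $0<q<1$ and let $a,b,c$ be non-zero complex numbers. For functions $f$ of a complex variable $z\neq0$, $$\bigl(\tilde D_q\circ S^{a,b,c}f\bigr)(z)=\frac1q\bigl(L^{aq,bq,cq}f\bigr)(z)+(1-q)(ab-q^{-1})f(z).$$ Moreover, if $L^{a,b,c}u=(1-a)(1-b)u$, then $f=\tilde D_qu$ satisfies $L^{aq,bq,cq}f=(1-aq)(1-bq)f$.
   Context: The operators are defined by $$(\tilde D_qu)(z)=\frac{u(qz)-u(z)}{z},\qquad (S^{a,b,c}f)(z)=(c-abz)f(z)-(1-z/q)f(z/q),$$ $$(L^{a,b,c}u)(z)=(c-abz)\frac{u(qz)-u(z)}{z}+(1-z/q)\frac{u(z/q)-u(z)}{z/q}.$$ *)

theory Defs
  imports Complex_Main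
begin

text \<open>
  Functions of a complex variable \<open>z \<noteq> 0\<close> are modelled by total functions; their value at \<open>0\<close> is
  irrelevant: for \<open>q \<noteq> 0\<close> and \<open>z \<noteq> 0\<close>, the operators below evaluate their argument only at the
  nonzero points \<open>q z\<close>, \<open>z\<close> and \<open>z / q\<close>.
\<close>

definition qdiff :: "real \<Rightarrow> (complex \<Rightarrow> complex) \<Rightarrow> complex \<Rightarrow> complex" where
  "qdiff q u z = (u (of_real q * z) - u z) / z"

definition S_op ::
  "real \<Rightarrow> complex \<Rightarrow> complex \<Rightarrow> complex \<Rightarrow> (complex \<Rightarrow> complex) \<Rightarrow> complex \<Rightarrow> complex" where
  "S_op q a b c f z = (c - a * b * z) * f z - (1 - z / of_real q) * f (z / of_real q)"

definition L_op ::
  "real \<Rightarrow> complex \<Rightarrow> complex \<Rightarrow> complex \<Rightarrow> (complex \<Rightarrow> complex) \<Rightarrow> complex \<Rightarrow> complex" where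
  "L_op q a b c u z =
     (c - a * b * z) * ((u (of_real q * z) - u z) / z)
     + (1 - z / of_real q) * ((u (z / of_real q) - u z) / (z / of_real q))"

end

theory Submission
  imports Defs
begin

text \<open>
  The point is that \<open>L\<close> factors through \<open>D = qdiff q\<close> as \<open>L = S \<circ> D\<close>
  (\<open>L_op_eq_S_op_qdiff\<close>), while in the opposite order \<open>D \<circ> S\<close> is, up to the factor \<open>1 / q\<close> and an additive constant, the same kind of operator
  with the parameters \<open>a, b, c\<close> multiplied by \<open>q\<close>
  (\<open>qdiff_S_op_eq_shifted_L_op\<close>).  This is a Darboux transformation: if \<open>u\<close> is an
  eigenfunction of \<open>S \<circ> D\<close>, then applying \<open>D\<close> to the eigenvalue equation shows that \<open>D u\<close> is
  an eigenfunction of \<open>D \<circ> S\<close> with the same eigenvalue \<open>(1 - a) (1 - b)\<close>.  Undoing the affine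
  change gives the eigenvalue of the shifted \<open>L\<close>,
  \<open>q (1 - a) (1 - b) - q (1 - q) (a b - 1 / q) = (1 - a q) (1 - b q)\<close>.
\<close>

text \<open>
  The backward difference quotient \<open>(u (z / q) - u z) / (z / q)\<close> in \<open>L\<close> is minus \<open>qdiff q u\<close> at \<open>z / q\<close>,
  which accounts for the second term of \<open>S\<close>.
\<close>

lemma L_op_eq_S_op_qdiff:
  assumes "q \<noteq> 0"
  shows "L_op q a b c u z = S_op q a b c (qdiff q u) z"
proof -
  have "qdiff q u (z / of_real q) = - ((u (z / of_real q) - u z) / (z / of_real q))"
    using assms by (simp add: qdiff_def algebra_simps diff_divide_distrib)
  then show ?thesis
    by (simp add: L_op_def S_op_def qdiff_def)
qed

text \<open>
  Both sides are combinations of \<open>f (q z)\<close>, \<open>f z\<close> and \<open>f (z / q)\<close>.  The coefficients of the two shifted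
  values agree at once; those of \<open>f z\<close> agree in their \<open>1 / z\<close> parts, and the additive constant makes up
  for the difference of the remaining parts, \<open>a b + 1\<close> on the left and \<open>a b q + 1 / q\<close>
  from \<open>L / q\<close>.
\<close>

lemma qdiff_S_op_eq_shifted_L_op:
  assumes "q \<noteq> 0" and "z \<noteq> 0"
  shows "qdiff q (S_op q a b c f) z
    = 1 / of_real q * L_op q (a * of_real q) (b * of_real q) (c * of_real q) f z
      + (1 - of_real q) * (a * b - 1 / of_real q) * f z"
proof -
  define r :: complex where "r = of_real q"
  have "r \<noteq> 0" using assms by (simp add: r_def)
  with assms(2) show ?thesis
    unfolding qdiff_def S_op_def L_op_def r_def [symmetric]
    by (simp add: field_simps)
qed

theorem lemma3p3:
  fixes q :: real and a b c :: complex
  assumes "0 < q" and "q < 1" and "a \<noteq> 0" and "b \<noteq> 0" and "c \<noteq> 0"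
  shows "(\<forall>f :: complex \<Rightarrow> complex. \<forall>z. z \<noteq> 0 \<longrightarrow>
            (qdiff q \<circ> S_op q a b c) f z
            = 1 / of_real q * L_op q (a * of_real q) (b * of_real q) (c * of_real q) f z
              + (1 - of_real q) * (a * b - 1 / of_real q) * f z)
       \<and> (\<forall>u f :: complex \<Rightarrow> complex.
            (\<forall>z. z \<noteq> 0 \<longrightarrow> L_op q a b c u z = (1 - a) * (1 - b) * u z) \<longrightarrow>
            (\<forall>z. z \<noteq> 0 \<longrightarrow> f z = qdiff q u z) \<longrightarrow>
            (\<forall>z. z \<noteq> 0 \<longrightarrow>
              L_op q (a * of_real q) (b * of_real q) (c * of_real q) f z
              = (1 - a * of_real q) * (1 - b * of_real q) * f z))"
proof (intro conjI allI impI)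
  fix f :: "complex \<Rightarrow> complex" and z :: complex
  assume "z \<noteq> 0"
  then show "(qdiff q \<circ> S_op q a b c) f z
      = 1 / of_real q * L_op q (a * of_real q) (b * of_real q) (c * of_real q) f z
        + (1 - of_real q) * (a * b - 1 / of_real q) * f z"
    using assms(1) qdiff_S_op_eq_shifted_L_op [of q z] by simp
next
  fix u f :: "complex \<Rightarrow> complex" and z :: complex
  assume eigen: "\<forall>z. z \<noteq> 0 \<longrightarrow> L_op q a b c u z = (1 - a) * (1 - b) * u z"
    and f: "\<forall>z. z \<noteq> 0 \<longrightarrow> f z = qdiff q u z"
    and z: "z \<noteq> 0"
  define r :: complex where "r = of_real q"
  have q: "q \<noteq> 0" and r: "r \<noteq> 0" using assms(1) by (simp_all add: r_def)
  \<comment> \<open>\<open>f\<close> and \<open>qdiff q u\<close> may differ at \<open>0\<close>, but \<open>S\<close> at \<open>w \<noteq> 0\<close> samples only \<open>w\<close> and \<open>w / q\<close>.\<close>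
  have S: "S_op q a b c f w = (1 - a) * (1 - b) * u w" if "w \<noteq> 0" for w
  proof -
    have "S_op q a b c f w = S_op q a b c (qdiff q u) w"
      using f q that by (simp add: S_op_def)
    also have "\<dots> = (1 - a) * (1 - b) * u w"
      using eigen that by (simp flip: L_op_eq_S_op_qdiff [OF q])
    finally show ?thesis .
  qed
  have "(1 - a) * (1 - b) * f z = qdiff q (S_op q a b c f) z"
    using f z q by (simp add: S qdiff_def right_diff_distrib)
  also have "\<dots> = 1 / r * L_op q (a * r) (b * r) (c * r) f z + (1 - r) * (a * b - 1 / r) * f z"
    unfolding r_def using q z by (rule qdiff_S_op_eq_shifted_L_op)
  finally have "1 / r * L_op q (a * r) (b * r) (c * r) f z
      = ((1 - a) * (1 - b) - (1 - r) * (a * b - 1 / r)) * f z"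
    by (simp add: left_diff_distrib)
  then have "r * (1 / r * L_op q (a * r) (b * r) (c * r) f z)
      = r * (((1 - a) * (1 - b) - (1 - r) * (a * b - 1 / r)) * f z)"
    by (rule arg_cong)
  then have "L_op q (a * r) (b * r) (c * r) f z
      = r * ((1 - a) * (1 - b) - (1 - r) * (a * b - 1 / r)) * f z"
    using r by (simp add: mult.assoc)
  also have "r * ((1 - a) * (1 - b) - (1 - r) * (a * b - 1 / r)) = (1 - a * r) * (1 - b * r)"
    using r by (simp add: field_simps)
  finally show "L_op q (a * of_real q) (b * of_real q) (c * of_real q) f z
      = (1 - a * of_real q) * (1 - b * of_real q) * f z"
    unfolding r_def .
qed

end
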